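(* Let $p$ be a prime with $p \equiv 5 \pmod{24}$ and let $a \in \{1,-1\}$. Then the ternary self-dual code $NV^{(a)}(p)$ of length $2(p+1)$ contains $2(p+1)$ codewords of weight $2(p+1)$ which, when their entries $0,1,2\in\mathbb{F}_3$ are read as the integers $0,1,-1$, form (as the rows of a $2(p+1)\times 2(p+1)$ matrix) a Hadamard matrix of order $2(p+1)$.
   Context: Let $p$ be a prime with $p\equiv 5\pmod 8$, let $\mathbb{F}_p$ be the field of order $p$ and $\chi$ its quadratic character. Fix an ordering of $\mathbb{F}_p$ and define $p\times p$ matrices $R_X=(r^X_{u,v})$, $R_Y=(r^Y_{u,v})$ indexed by $\mathbb{F}_p$: $r^X_{u,v}=0$ if $u=v$ or $v-u$ is not a nonzero square, and $r^X_{u,v}=\chi(c)$ if $v-u=c^2$ with $c\neq 0$; $r^Y_{u,v}=0$ if $u=v$ or $2(v-u)$ is not a nonzero square, and $r^Y_{u,v}=\chi(c)$ if $2(v-u)=c^2$ with $c\ne 0$. Let $X$ be the $(p+1)\times(p+1)$ matrix with first row $(0,1,\dots,1)$, first column $(0,-1,\dots,-1)^T$ and lower-right $p\times p$ block $R_X$; let $Y$ be the $(p+1)\times(p+1)$ matrix with zero first row and column and lower-right block $R_Y$. For $p\equiv 5\pmod{24}$ and $a\in\{1,-1\}$, $NV^{(a)}(p)$ is the ternary code (subspace of $\mathbb{F}_3^{2(p+1)}$) generated by the rows of $aI_{2(p+1)}+\begin{pmatrix} X & Y\\ -Y^T & X^T\end{pmatrix}$, entries reduced modulo $3$; it is self-dual.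 The weight of a vector is its number of nonzero entries. A Hadamard matrix of order $n$ is an $n\times n$ matrix $H$ with entries in $\{1,-1\}$ and $HH^T=nI_n$. *)

theory Defs
  imports
    "HOL-Number_Theory.Cong"
    "Berlekamp_Zassenhaus.Finite_Field"
    "Jordan_Normal_Form.VS_Connect"
begin

definition quad_char :: "'k::field \<Rightarrow> int" where
  "quad_char x = (if x = 0 then 0 else if (\<exists>y. x = y ^ 2) then 1 else -1)"

text \<open>
  The value \<open>\<chi>(c)\<close> for a square root \<open>c\<close> of \<open>d \<noteq> 0\<close>, and \<open>0\<close> if \<open>d\<close> is not a nonzero square.
  If \<open>-1\<close> is a square (so in particular over a field whose order is a prime congruent to 5
  modulo 8), then \<open>\<chi>(-c) = \<chi>(c)\<close>, and the value does not depend on the root that \<open>SOME\<close> picks.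
\<close>
definition root_char :: "'k::field \<Rightarrow> int" where
  "root_char d =
     (if \<exists>c. c \<noteq> 0 \<and> d = c ^ 2 then quad_char (SOME c. c \<noteq> 0 \<and> d = c ^ 2) else 0)"

definition rX :: "'k::field \<Rightarrow> 'k \<Rightarrow> int" where
  "rX u v = root_char (v - u)"

definition rY :: "'k::field \<Rightarrow> 'k \<Rightarrow> int" where
  "rY u v = root_char (2 * (v - u))"

text \<open>
  The ordering of the field is an enumeration \<open>e\<close>, which is meant to be a bijection from
  \<open>{..<CARD('k)}\<close> onto the field. In \<open>mat_X\<close> and \<open>mat_Y\<close> the index \<open>0\<close> is the border and the
  index \<open>Suc i\<close> stands for the field element \<open>e i\<close>.
\<close>
definition mat_X :: "(nat \<Rightarrow> 'k::{finite, field}) \<Rightarrow> int mat" where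
  "mat_X e = mat (CARD('k) + 1) (CARD('k) + 1) (\<lambda>(i, j).
     if i = 0 \<and> j = 0 then 0
     else if i = 0 then 1
     else if j = 0 then -1
     else rX (e (i - 1)) (e (j - 1)))"

definition mat_Y :: "(nat \<Rightarrow> 'k::{finite, field}) \<Rightarrow> int mat" where
  "mat_Y e = mat (CARD('k) + 1) (CARD('k) + 1) (\<lambda>(i, j).
     if i = 0 \<or> j = 0 then 0 else rY (e (i - 1)) (e (j - 1)))"

instance Enum.finite_3 :: prime_card
proof
  have "CARD(Enum.finite_3) = 3"
    by (simp add: UNIV_finite_3)
  moreover have "prime (3 :: nat)"
    by simp
  ultimately show "prime (CARD(Enum.finite_3))"
    by simp
qed

type_synonym F3 = "Enum.finite_3 mod_ring"

definition NV_generator :: "int \<Rightarrow> (nat \<Rightarrow> 'k::{finite, field}) \<Rightarrow> int mat" where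
  "NV_generator a e =
     a \<cdot>\<^sub>m 1\<^sub>m (2 * (CARD('k) + 1))
       + four_block_mat (mat_X e) (mat_Y e) (- transpose_mat (mat_Y e)) (transpose_mat (mat_X e))"

definition NV :: "int \<Rightarrow> (nat \<Rightarrow> 'k::{finite, field}) \<Rightarrow> F3 vec set" where
  "NV a e = vec_space.row_space (2 * (CARD('k) + 1)) (map_mat of_int (NV_generator a e))"

definition self_dual_code :: "nat \<Rightarrow> 'f::field vec set \<Rightarrow> bool" where
  "self_dual_code n C \<longleftrightarrow> C = {x \<in> carrier_vec n. \<forall>c \<in> C. x \<bullet> c = 0}"

definition weight :: "'f::zero vec \<Rightarrow> nat" where
  "weight v = card {i. i < dim_vec v \<and> v $ i \<noteq> 0}"

definition F3_to_int :: "F3 \<Rightarrow> int" where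
  "F3_to_int x = (if x = 0 then 0 else if x = 1 then 1 else -1)"

definition hadamard_matrix :: "nat \<Rightarrow> int mat \<Rightarrow> bool" where
  "hadamard_matrix n H \<longleftrightarrow>
     H \<in> carrier_mat n n \<and> (\<forall>i<n. \<forall>j<n. H $$ (i, j) \<in> {1, -1}) \<and>
     H * transpose_mat H = int n \<cdot>\<^sub>m 1\<^sub>m n"

end

theory Submission
  imports Defs
begin

text \<open>
  Since \<open>p \<equiv> 5 (mod 8)\<close>, a square root of \<open>-1\<close> and the element \<open>2\<close> are both nonsquares. Hence
  \<open>X\<close> and \<open>Y\<close> are skew, their off-diagonal supports are complementary, and \<open>d \<mapsto> root_char d\<close>,
  \<open>d \<mapsto> root_char (2 d)\<close> are, up to sign, the real and the imaginary part of a quartic character.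
  Orthogonality of that character gives \<open>X\<^sup>2 + Y\<^sup>2 = -p I\<close>, so the generator \<open>G = a I + W\<close>, with \<open>W\<close>
  the skew block matrix, satisfies \<open>G G\<^sup>T = (p + 1) I\<close> and \<open>G + G\<^sup>T = 2 a I\<close>. Modulo \<open>3\<close> the first
  identity makes the code self-orthogonal, and the second gives \<open>G\<^sup>T x = 2 a x\<close> whenever
  \<open>G x = 0\<close>, so the dual lies in the row space. The Hadamard matrix is
  \<open>H = K G\<close> with \<open>K\<close> built from the blocks \<open>I, I, -I, I\<close>: the blocks of \<open>H\<close> are
  \<open>\<plusminus>(a I + X) + Y\<close> and \<open>\<plusminus>Y + (a I - X)\<close>, with entries \<open>\<plusminus>1\<close>, and
  \<open>H H\<^sup>T = (p + 1) K K\<^sup>T = 2 (p + 1) I\<close>.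
\<close>

subsection \<open>Square roots and the quadratic character\<close>

text \<open>The characteristic divides the odd order of the field, so it cannot also divide
  \<open>2\<close>.\<close>

lemma two_neq_zero_if_odd_card:
  assumes "odd CARD('k::{finite, field})"
  shows "(2 :: 'k) \<noteq> 0"
proof
  assume "(2 :: 'k) = 0"
  hence "of_nat 2 = (0 :: 'k)" by simp
  hence "CHAR('k) dvd 2" by (simp only: of_nat_eq_0_iff_char_dvd)
  moreover have "CHAR('k) dvd CARD('k)" by (rule CHAR_dvd_CARD)
  ultimately have "CHAR('k) dvd 1"
    using assms by (metis coprime_left_2_iff_odd coprime_def)
  thus False by simp
qed

text \<open>Multiplication by \<open>x\<close> permutes the nonzero elements, so their product
  absorbs the factor \<open>x ^ (CARD('k) - 1)\<close> and cancels.\<close>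

lemma power_card_diff_1:
  fixes x :: "'k::{finite, field}"
  assumes "x \<noteq> 0"
  shows "x ^ (CARD('k) - 1) = 1"
proof -
  have "(\<Prod>y\<in>UNIV - {0}. x * y) = (\<Prod>y\<in>UNIV - {0}. y)"
    by (rule prod.reindex_bij_witness[of _ "\<lambda>y. y / x" "\<lambda>y. x * y"]) (use assms in auto)
  hence "x ^ (CARD('k) - 1) * (\<Prod>y\<in>UNIV - {0 :: 'k}. y) = (\<Prod>y\<in>UNIV - {0}. y)"
    by (simp add: prod.distrib card_Diff_subset)
  thus ?thesis by simp
qed

text \<open>Squaring maps the nonzero elements onto the nonzero squares, with fibres of at most two
  elements.\<close>

lemma card_nonzero_squares_ge:
  "CARD('k::{finite, field}) - 1 \<le> 2 * card {x :: 'k. x \<noteq> 0 \<and> (\<exists>y. x = y\<^sup>2)}"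
proof -
  let ?S = "{x :: 'k. x \<noteq> 0 \<and> (\<exists>y. x = y\<^sup>2)}"
  have "- {0} = (\<Union>x\<in>?S. {y :: 'k. y\<^sup>2 = x})" by auto
  hence "card (- {0 :: 'k}) \<le> (\<Sum>x\<in>?S. card {y :: 'k. y\<^sup>2 = x})"
    by (simp add: card_UN_le)
  also have "\<dots> \<le> (\<Sum>x\<in>?S. 2)"
  proof (rule sum_mono)
    fix x :: 'k assume "x \<in> ?S"
    then obtain y where y: "x = y\<^sup>2" by auto
    have "{y :: 'k. y\<^sup>2 = x} \<subseteq> {y, -y}" using y by (auto simp: power2_eq_iff)
    hence "card {y :: 'k. y\<^sup>2 = x} \<le> card {y, -y}" by (intro card_mono) auto
    also have "\<dots> \<le> 2" by (simp add: card_insert_if)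
    finally show "card {y :: 'k. y\<^sup>2 = x} \<le> 2" .
  qed
  also have "card (- {0 :: 'k}) = CARD('k) - 1" by (simp add: card_Diff_subset Compl_eq_Diff_UNIV)
  finally show ?thesis by simp
qed

lemma card_roots_of_unity_le:
  assumes "n > 0"
  shows "card {x :: 'k::{finite, field}. x ^ n = 1} \<le> n"
proof -
  let ?q = "monom 1 n - 1 :: 'k poly"
  have deg: "degree (monom 1 n - 1 :: 'k poly) = n"
    using assms by (subst diff_conv_add_uminus, subst degree_add_eq_left) (auto simp: degree_monom_eq)
  hence "?q \<noteq> 0" using assms by auto
  hence "card {x. poly ?q x = 0} \<le> n" using card_poly_roots_bound[of ?q] deg by simp
  thus ?thesis by (simp add: poly_monom)
qed

text \<open>Euler's criterion by counting: with \<open>n = (CARD('k) - 1) div 2\<close>, the nonzero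
  squares lie among the roots of \<open>x ^ n = 1\<close>; there are at least \<open>n\<close> of
  the former and at most \<open>n\<close> of the latter, so the two sets coincide.\<close>

lemma is_square_iff_power:
  fixes x :: "'k::{finite, field}"
  assumes "odd CARD('k)" and "x \<noteq> 0"
  shows "(\<exists>y. x = y\<^sup>2) \<longleftrightarrow> x ^ ((CARD('k) - 1) div 2) = 1"
proof -
  define n where "n = (CARD('k) - 1) div 2"
  have "CARD('k) \<ge> 2"
    using card_mono[of UNIV "{0, 1 :: 'k}"] by simp
  hence n: "CARD('k) - 1 = 2 * n" "n > 0"
    using assms(1) unfolding n_def by (auto elim!: oddE)
  let ?S = "{x :: 'k. x \<noteq> 0 \<and> (\<exists>y. x = y\<^sup>2)}"
  have "?S \<subseteq> {x. x ^ n = 1}"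
    using power_card_diff_1[where 'k = 'k] n by (auto simp flip: power_mult)
  moreover have "card {x :: 'k. x ^ n = 1} \<le> card ?S"
    using card_roots_of_unity_le[OF n(2), where 'k = 'k] card_nonzero_squares_ge[where 'k = 'k] n
    by linarith
  ultimately have "?S = {x. x ^ n = 1}"
    by (intro card_seteq) auto
  thus ?thesis using assms(2) unfolding n_def[symmetric] by blast
qed

lemma power_half_card:
  fixes x :: "'k::{finite, field}"
  assumes "odd CARD('k)" and "x \<noteq> 0"
  shows "x ^ ((CARD('k) - 1) div 2) \<in> {1, -1}"
proof -
  have "(x ^ ((CARD('k) - 1) div 2))\<^sup>2 = x ^ (CARD('k) - 1)"
    using assms(1) by (simp flip: power_mult)
  thus ?thesis using power_card_diff_1[OF assms(2)] by (simp add: power2_eq_1_iff)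
qed

lemma quad_char_euler:
  fixes x :: "'k::{finite, field}"
  assumes "odd CARD('k)"
  shows "of_int (quad_char x) = x ^ ((CARD('k) - 1) div 2)"
proof (cases "x = 0")
  case True
  \<comment> \<open>Together with oddness this makes the exponent positive, so that the power of
    \<open>0\<close> is \<open>0\<close>.\<close>
  have "CARD('k) \<ge> 2"
    using card_mono[of UNIV "{0, 1 :: 'k}"] by simp
  thus ?thesis using True assms by (auto simp: quad_char_def elim!: oddE)
next
  case False
  thus ?thesis
    using power_half_card[OF assms False] is_square_iff_power[OF assms False]
    by (auto simp: quad_char_def)
qed

lemma quad_char_values: "quad_char x \<in> {-1, 0, 1}"
  by (simp add: quad_char_def)

lemma quad_char_eq_0_iff: "quad_char x = 0 \<longleftrightarrow> x = 0"
  by (simp add: quad_char_def)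

text \<open>Powers are multiplicative, so both sides agree in the field; they agree as integers
  because \<open>-1\<close>, \<open>0\<close>, \<open>1\<close> stay distinct in odd
  characteristic.\<close>

lemma quad_char_mult:
  fixes x y :: "'k::{finite, field}"
  assumes "odd CARD('k)"
  shows "quad_char (x * y) = quad_char x * quad_char y"
proof -
  have two: "(1 :: 'k) \<noteq> -1" using two_neq_zero_if_odd_card[OF assms]
    by (metis add.right_inverse one_add_one)
  have "of_int (quad_char (x * y)) = (of_int (quad_char x * quad_char y) :: 'k)"
    unfolding of_int_mult quad_char_euler[OF assms] by (simp add: power_mult_distrib)
  thus ?thesis
    using quad_char_values[of x] quad_char_values[of y] quad_char_values[of "x * y"] two two[symmetric]
    by auto
qed

lemma quad_char_square:
  assumes "x \<noteq> 0"
  shows "quad_char (x\<^sup>2) = 1"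
  using assms by (auto simp: quad_char_def)

lemma quad_char_minus_one:
  assumes "CARD('k::{finite, field}) mod 4 = 1"
  shows "quad_char (-1 :: 'k) = 1"
proof -
  have odd: "odd CARD('k)" using assms by presburger
  have "even ((CARD('k) - 1) div 2)" using assms by presburger
  thus ?thesis using is_square_iff_power[OF odd, of "-1"] by (simp add: quad_char_def)
qed

lemma quad_char_sqrt_minus_one:
  fixes i :: "'k::{finite, field}"
  assumes "CARD('k) mod 8 = 5" and "i\<^sup>2 = -1"
  shows "quad_char i = -1"
proof -
  have odd: "odd CARD('k)" using assms by presburger
  \<comment> \<open>The Euler exponent is twice an odd number, so the power of \<open>i\<close> is
    an odd power of \<open>-1\<close>.\<close>
  have "(CARD('k) - 1) div 2 = 2 * (2 * ((CARD('k) - 1) div 8) + 1)" using assms(1) by presburger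
  hence "i ^ ((CARD('k) - 1) div 2) = (i\<^sup>2) ^ (2 * ((CARD('k) - 1) div 8) + 1)"
    by (metis power_mult)
  also have "\<dots> = -1" unfolding assms(2) by simp
  also have "\<dots> \<noteq> (1 :: 'k)"
    using two_neq_zero_if_odd_card[OF odd] by (metis add.right_inverse one_add_one)
  finally show ?thesis using assms(2) is_square_iff_power[OF odd, of i] by (auto simp: quad_char_def)
qed

lemma ex_sqrt_minus_one:
  assumes "CARD('k) mod 8 = 5"
  obtains i :: "'k::{finite, field}" where "i\<^sup>2 = -1" "quad_char i = -1"
proof -
  have "CARD('k) mod 4 = 1" using assms by presburger
  hence "\<exists>i :: 'k. i\<^sup>2 = -1"
    using quad_char_minus_one[where 'k = 'k] by (auto simp: quad_char_def split: if_splits dest: sym)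
  thus ?thesis using that quad_char_sqrt_minus_one[OF assms] by blast
qed

text \<open>Here \<open>2\<close> equals \<open>-i (1 + i)\<^sup>2\<close> with \<open>i\<^sup>2 = -1\<close>.\<close>
lemma quad_char_two:
  assumes "CARD('k::{finite, field}) mod 8 = 5"
  shows "quad_char (2 :: 'k) = -1"
proof -
  have odd: "odd CARD('k)" using assms by presburger
  obtain i :: 'k where i: "i\<^sup>2 = -1" "quad_char i = -1" using ex_sqrt_minus_one[OF assms] .
  have "(-i)\<^sup>2 = -1" using i by simp
  hence "quad_char (-i) = -1" by (rule quad_char_sqrt_minus_one[OF assms])
  moreover have "(1 + i)\<^sup>2 = 2 * i" using i(1) by (simp add: power2_sum)
  hence two: "2 = (-i) * (1 + i)\<^sup>2" using i(1) by (simp add: power2_eq_square mult.left_commute[of i 2])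
  moreover have "1 + i \<noteq> 0" using two two_neq_zero_if_odd_card[OF odd] by auto
  ultimately show ?thesis using quad_char_mult[OF odd, of "-i" "(1 + i)\<^sup>2"] quad_char_square[of "1 + i"]
    by simp
qed

section \<open>Signs and multiplicativity of the root character\<close>

lemma root_char_0 [simp]: "root_char 0 = 0"
  by (simp add: root_char_def)

lemma root_char_eq_0_iff: "root_char x = 0 \<longleftrightarrow> quad_char x \<noteq> 1"
proof (cases "\<exists>c. c \<noteq> 0 \<and> x = c ^ 2")
  case True
  from someI_ex[OF this] have "(SOME c. c \<noteq> 0 \<and> x = c ^ 2) \<noteq> 0" by blast
  thus ?thesis using True by (auto simp: root_char_def quad_char_def)
next
  case False
  thus ?thesis by (auto simp: root_char_def quad_char_def)
qed

lemma root_char_values: "root_char x \<in> {-1, 0, 1}"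
  using quad_char_values by (auto simp: root_char_def)

text \<open>The two roots differ by a sign and \<open>quad_char (-1) = 1\<close>, so the choice made
  by \<open>SOME\<close> does not matter.\<close>

lemma root_char_square:
  fixes c :: "'k::{finite, field}"
  assumes "CARD('k) mod 4 = 1"
  shows "root_char (c\<^sup>2) = quad_char c"
proof (cases "c = 0")
  case True
  thus ?thesis by (simp add: quad_char_def)
next
  case False
  have odd: "odd CARD('k)" using assms by presburger
  have ex: "\<exists>d. d \<noteq> 0 \<and> c\<^sup>2 = d\<^sup>2" using False by blast
  define d where "d = (SOME d. d \<noteq> 0 \<and> c\<^sup>2 = d\<^sup>2)"
  have "c\<^sup>2 = d\<^sup>2" using someI_ex[OF ex] unfolding d_def by blast
  hence "d = c \<or> d = -1 * c" by (auto simp: power2_eq_iff)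
  hence "quad_char d = quad_char c"
    using quad_char_mult[OF odd, of "-1" c] quad_char_minus_one[OF assms] by auto
  thus ?thesis using ex unfolding root_char_def d_def by simp
qed

text \<open>If \<open>x = c^2\<close>, then \<open>-x = (i c)^2\<close> with \<open>i^2 = -1\<close>
  and \<open>quad_char i = -1\<close>; this includes \<open>x = 0\<close>. If \<open>x\<close> is a
  nonsquare, so is \<open>-x\<close>, and both values are \<open>0\<close>.\<close>

lemma root_char_minus:
  fixes x :: "'k::{finite, field}"
  assumes "CARD('k) mod 8 = 5"
  shows "root_char (-x) = - root_char x"
proof -
  have odd: "odd CARD('k)" and c4: "CARD('k) mod 4 = 1" using assms by presburger+
  obtain i :: 'k where i: "i\<^sup>2 = -1" "quad_char i = -1" using ex_sqrt_minus_one[OF assms] .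
  show ?thesis
  proof (cases "quad_char x \<in> {0, 1}")
    case True
    then obtain c where c: "x = c\<^sup>2" by (auto simp: quad_char_def split: if_splits)
    have "-x = (i * c)\<^sup>2" by (simp add: c i power_mult_distrib)
    thus ?thesis using root_char_square[OF c4, of "i * c"] root_char_square[OF c4, of c]
        quad_char_mult[OF odd, of i c] i c by simp
  next
    case False
    hence "quad_char (-x) \<noteq> 1" "quad_char x \<noteq> 1"
      using quad_char_mult[OF odd, of "-1" x] quad_char_minus_one[OF c4] by auto
    hence "root_char (-x) = 0" "root_char x = 0" by (simp_all only: root_char_eq_0_iff) auto
    thus ?thesis by simp
  qed
qed

lemma quad_char_divide:
  fixes x y :: "'k::{finite, field}"
  assumes "odd CARD('k)"
  shows "quad_char (x / y) = quad_char x * quad_char y"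
proof (cases "y = 0")
  case True
  thus ?thesis by (simp add: quad_char_def)
next
  case False
  hence "quad_char (x / y) * quad_char y = quad_char x"
    using quad_char_mult[OF assms, of "x / y" y] by simp
  thus ?thesis using False quad_char_values[of y] quad_char_values[of "x / y"]
    by (auto simp: quad_char_def[of y] split: if_splits)
qed

lemma root_char_divide:
  fixes x y :: "'k::{finite, field}"
  assumes "CARD('k) mod 4 = 1" and "quad_char x = 1" and "quad_char y = 1"
  shows "root_char (x / y) = root_char x * root_char y"
proof -
  have odd: "odd CARD('k)" using assms(1) by presburger
  obtain c d where cd: "x = c\<^sup>2" "y = d\<^sup>2"
    using assms(2,3) by (auto simp: quad_char_def split: if_splits)
  show ?thesis using root_char_square[OF assms(1)] quad_char_divide[OF odd]
    unfolding cd by (simp flip: power_divide)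
qed

text \<open>
  With a quartic character \<open>\<psi>\<close>, \<open>root_char x = Re (\<psi> x)\<close> and \<open>root_char (2 * x) = \<plusminus> Im (\<psi> x)\<close>;
  the identity is \<open>Re (\<psi> x * cnj (\<psi> y)) = Re (\<psi> (x / y))\<close>, which persists for \<open>y = 0\<close> because \<open>x / 0 = 0\<close>.
\<close>
lemma root_char_correlation:
  fixes x y :: "'k::{finite, field}"
  assumes "CARD('k) mod 8 = 5"
  shows "root_char x * root_char y + root_char (2 * x) * root_char (2 * y) = root_char (x / y)"
proof -
  have odd: "odd CARD('k)" and c4: "CARD('k) mod 4 = 1" using assms by presburger+
  note zero = root_char_eq_0_iff[THEN iffD2]
  have two: "quad_char (2 * z) = - quad_char z" for z :: 'k
    using quad_char_mult[OF odd, of 2 z] quad_char_two[OF assms] by simp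
  have two0: "(2 :: 'k) \<noteq> 0" using two_neq_zero_if_odd_card[OF odd] .
  \<comment> \<open>As \<open>2\<close> is a nonsquare, only the first product survives for two
    squares and only the second for two nonsquares; in the mixed case both products and the
    right-hand side vanish.\<close>
  consider "x = 0 \<or> y = 0" | "quad_char x = 1" "quad_char y = 1" | "quad_char x = -1" "quad_char y = -1"
    | "quad_char x * quad_char y = -1"
    using quad_char_values[of x] quad_char_values[of y] by (auto simp: quad_char_eq_0_iff)
  thus ?thesis
  proof cases
    case 1
    thus ?thesis by auto
  next
    case 2
    thus ?thesis using root_char_divide[OF c4 2] zero[of "2 * x"] two[of x] by simp
  next
    case 3
    \<comment> \<open>Doubling turns both nonsquares into squares and leaves their quotient
      unchanged.\<close>
    have "root_char ((2 * x) / (2 * y)) = root_char (2 * x) * root_char (2 * y)"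
      by (rule root_char_divide[OF c4]) (simp_all add: two 3)
    thus ?thesis using zero[of x] 3 two0 by simp
  next
    case 4
    hence "quad_char x = 1 \<and> quad_char y = -1 \<or> quad_char x = -1 \<and> quad_char y = 1"
      using quad_char_values[of x] quad_char_values[of y] by auto
    moreover have "root_char (x / y) = 0" using 4 by (intro zero) (simp add: quad_char_divide[OF odd])
    ultimately show ?thesis using zero[of x] zero[of y] zero[of "2 * x"] zero[of "2 * y"]
      by (auto simp: two)
  qed
qed

section \<open>Sums of the root character\<close>

lemma sum_root_char:
  assumes "CARD('k::{finite, field}) mod 8 = 5"
  shows "(\<Sum>x\<in>(UNIV :: 'k set). root_char (b * (x - u))) = 0"
proof -
  \<comment> \<open>Translation removes \<open>u\<close>; the reflection
    \<open>x \<mapsto> -x\<close> then shows that the sum equals its own negative.\<close>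
  have "(\<Sum>x\<in>(UNIV :: 'k set). root_char (b * (x - u))) = (\<Sum>x\<in>UNIV. root_char (b * x))"
    by (rule sum.reindex_bij_witness[of _ "\<lambda>x. x + u" "\<lambda>x. x - u"]) auto
  moreover have "(\<Sum>x\<in>(UNIV :: 'k set). root_char (b * x)) = (\<Sum>x\<in>UNIV. root_char (b * (-x)))"
    by (rule sum.reindex_bij_witness[of _ uminus uminus]) auto
  moreover have "\<dots> = - (\<Sum>x\<in>UNIV. root_char (b * x))"
    using root_char_minus[OF assms] by (simp add: sum_negf)
  ultimately show ?thesis by simp
qed

text \<open>The Moebius map \<open>x \<mapsto> x / (x + d)\<close> takes every value except
  \<open>1\<close> exactly once away from its pole, so the full sum \<open>0\<close> loses just the
  term \<open>root_char 1 = 1\<close>.\<close>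

lemma sum_root_char_quotient:
  fixes d :: "'k::{finite, field}"
  assumes "CARD('k) mod 8 = 5" and "d \<noteq> 0"
  shows "(\<Sum>x\<in>UNIV. root_char (x / (x + d))) = -1"
proof -
  have c4: "CARD('k) mod 4 = 1" using assms by presburger
  \<comment> \<open>At the pole \<open>x = -d\<close> division by zero gives
    \<open>root_char 0 = 0\<close>.\<close>
  have "(\<Sum>x\<in>UNIV. root_char (x / (x + d))) = (\<Sum>x\<in>-{-d}. root_char (x / (x + d)))"
    by (rule sum.mono_neutral_right) auto
  also have "\<dots> = (\<Sum>t\<in>-{1 :: 'k}. root_char t)"
  proof (rule sum.reindex_bij_witness[of _ "\<lambda>t. t * d / (1 - t)" "\<lambda>x. x / (x + d)"])
    fix x assume "x \<in> - {-d}"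
    hence nz: "x + d \<noteq> 0" by (metis ComplD add_eq_0_iff2 singletonI)
    hence "1 - x / (x + d) = d / (x + d)" by (simp add: field_simps)
    thus "x / (x + d) * d / (1 - x / (x + d)) = x" using assms nz by simp
    show "x / (x + d) \<in> - {1}" using assms nz by (auto simp: divide_eq_1_iff)
  next
    fix t :: 'k assume "t \<in> - {1}"
    hence nz: "1 - t \<noteq> 0" by auto
    hence eq: "t * d / (1 - t) + d = d / (1 - t)" by (simp add: field_simps)
    show "t * d / (1 - t) / (t * d / (1 - t) + d) = t" unfolding eq using assms nz by simp
    show "t * d / (1 - t) \<in> - {-d}" using eq assms nz by (auto simp: add_eq_0_iff2)
  qed auto
  also have "\<dots> = (\<Sum>t\<in>(UNIV :: 'k set). root_char t) - root_char (1 :: 'k)"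
    by (subst Compl_eq_Diff_UNIV, subst sum_diff1) auto
  also have "\<dots> = -1"
    using sum_root_char[OF assms(1), of 1 0] root_char_square[OF c4, of 1] quad_char_square[of "1 :: 'k"]
    by simp
  finally show ?thesis .
qed

section \<open>The cores of X and Y\<close>

lemma rX_antisym:
  fixes u v :: "'k::{finite, field}"
  assumes "CARD('k) mod 8 = 5"
  shows "rX v u = - rX u v"
  using root_char_minus[OF assms, of "v - u"] by (simp add: rX_def)

lemma rY_antisym:
  fixes u v :: "'k::{finite, field}"
  assumes "CARD('k) mod 8 = 5"
  shows "rY v u = - rY u v"
  using root_char_minus[OF assms, of "2 * (v - u)"] by (simp add: rY_def algebra_simps)

lemma sum_rX:
  fixes u v :: "'k::{finite, field}"
  assumes "CARD('k) mod 8 = 5"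
  shows "(\<Sum>w\<in>UNIV. rX u w) = 0" "(\<Sum>w\<in>UNIV. rX w v) = 0"
proof -
  show row: "(\<Sum>w\<in>UNIV. rX u w) = 0" for u :: 'k
    using sum_root_char[OF assms, of 1] by (simp add: rX_def)
  show "(\<Sum>w\<in>UNIV. rX w v) = 0"
    by (subst rX_antisym[OF assms]) (simp add: sum_negf row)
qed

lemma sum_rY:
  fixes u v :: "'k::{finite, field}"
  assumes "CARD('k) mod 8 = 5"
  shows "(\<Sum>w\<in>UNIV. rY u w) = 0" "(\<Sum>w\<in>UNIV. rY w v) = 0"
proof -
  show row: "(\<Sum>w\<in>UNIV. rY u w) = 0" for u :: 'k
    using sum_root_char[OF assms, of 2] by (simp add: rY_def)
  show "(\<Sum>w\<in>UNIV. rY w v) = 0"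
    by (subst rY_antisym[OF assms]) (simp add: sum_negf row)
qed

text \<open>Both kernels depend only on the difference of their arguments, and the reflection
  \<open>w \<mapsto> u + v - w\<close> exchanges \<open>w - u\<close> with
  \<open>v - w\<close>.\<close>

lemma sum_rX_rY_commute:
  fixes u v :: "'k::{finite, field}"
  shows "(\<Sum>w\<in>UNIV. rX u w * rY w v) = (\<Sum>w\<in>UNIV. rY u w * rX w v)"
  by (rule sum.reindex_bij_witness[of _ "\<lambda>w. u + v - w" "\<lambda>w. u + v - w"])
    (auto simp: rX_def rY_def algebra_simps)

text \<open>Skewness turns the summand into minus a correlation, hence into
  \<open>- root_char ((w - u) / (w - v))\<close>. The quotient is \<open>1\<close> for all
  \<open>w \<noteq> u\<close> if \<open>u = v\<close>, and runs through a Moebius map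
  otherwise.\<close>

lemma sum_rX_rX_plus_rY_rY:
  fixes u v :: "'k::{finite, field}"
  assumes "CARD('k) mod 8 = 5"
  shows "(\<Sum>w\<in>UNIV. rX u w * rX w v + rY u w * rY w v) = (if u = v then 1 - int CARD('k) else 1)"
proof -
  have c4: "CARD('k) mod 4 = 1" using assms by presburger
  have "rX u w * rX w v + rY u w * rY w v = - root_char ((w - u) / (w - v))" for w
    unfolding root_char_correlation[OF assms, symmetric]
    by (subst rX_antisym[OF assms, of w v], subst rY_antisym[OF assms, of w v])
      (simp add: rX_def rY_def)
  hence "(\<Sum>w\<in>UNIV. rX u w * rX w v + rY u w * rY w v)
      = - (\<Sum>w\<in>UNIV. root_char ((w - u) / (w - v)))" by (simp add: sum_negf)
  also have "(\<Sum>w\<in>UNIV. root_char ((w - u) / (w - v))) = (\<Sum>x\<in>UNIV. root_char (x / (x + (u - v))))"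
    by (rule sum.reindex_bij_witness[of _ "\<lambda>w. w + u" "\<lambda>w. w - u"]) auto
  also have "\<dots> = (if u = v then int CARD('k) - 1 else -1)"
  proof (cases "u = v")
    case True
    have one: "root_char (1 :: 'k) = 1"
      using root_char_square[OF c4, of 1] quad_char_square[of "1 :: 'k"] by simp
    \<comment> \<open>The term at \<open>0\<close> vanishes because \<open>0 / 0 = 0\<close>, which
      leaves one term fewer than the order of the field.\<close>
    have "(\<Sum>x\<in>(UNIV :: 'k set). root_char (x / x)) = (\<Sum>x\<in>-{0 :: 'k}. root_char (x / x))"
      by (rule sum.mono_neutral_right) auto
    also have "\<dots> = (\<Sum>x\<in>-{0 :: 'k}. 1)" by (rule sum.cong) (auto simp: one)
    also have "\<dots> = int CARD('k) - 1"
      by (simp add: Compl_eq_Diff_UNIV card_Diff_subset of_nat_diff Suc_le_eq)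
    finally show ?thesis using True by simp
  next
    case False
    thus ?thesis using sum_root_char_quotient[OF assms, of "u - v"] by simp
  qed
  finally show ?thesis by simp
qed

subsection \<open>The matrices X and Y\<close>

text \<open>A common shape for \<open>mat_X\<close>, \<open>mat_Y\<close> and their products, so
  that one multiplication rule serves them all.\<close>

definition bordered ::
  "int \<Rightarrow> int \<Rightarrow> int \<Rightarrow> ('k \<Rightarrow> 'k \<Rightarrow> int) \<Rightarrow> (nat \<Rightarrow> 'k::finite) \<Rightarrow> int mat" where
  "bordered a b c R e = mat (CARD('k) + 1) (CARD('k) + 1) (\<lambda>(i, j).
     if i = 0 \<and> j = 0 then a else if i = 0 then b else if j = 0 then c
     else R (e (i - 1)) (e (j - 1)))"

lemma sum_bordered:
  fixes e :: "nat \<Rightarrow> 'k::finite" and g :: "'k \<Rightarrow> int"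
  assumes "bij_betw e {..<CARD('k)} UNIV"
  shows "(\<Sum>k<CARD('k) + 1. if k = 0 then c else g (e (k - 1))) = c + (\<Sum>w\<in>UNIV. g w)"
  using sum.reindex_bij_betw[OF assms, of g] by (simp add: sum.lessThan_Suc_shift del: sum.lessThan_Suc)

text \<open>Vanishing row sums of \<open>R\<close> and column sums of \<open>R'\<close> remove the
  mixed terms of border and core, so the product is bordered again.\<close>

lemma bordered_mult:
  fixes e :: "nat \<Rightarrow> 'k::finite"
  assumes e: "bij_betw e {..<CARD('k)} UNIV"
    and R: "\<And>u. (\<Sum>w\<in>UNIV. R u w) = 0" and R': "\<And>v. (\<Sum>w\<in>UNIV. R' w v) = 0"
  shows "bordered a b c R e * bordered a' b' c' R' e =
    bordered (a * a' + int CARD('k) * b * c') (a * b') (c * a')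
      (\<lambda>u v. c * b' + (\<Sum>w\<in>UNIV. R u w * R' w v)) e"
    (is "?A * ?B = ?C")
proof (rule eq_matI)
  let ?n = "CARD('k) + 1"
  fix i j assume "i < dim_row ?C" "j < dim_col ?C"
  hence ij: "i < ?n" "j < ?n" by (simp_all add: bordered_def)
  have "(?A * ?B) $$ (i, j) = (\<Sum>k<?n. ?A $$ (i, k) * ?B $$ (k, j))"
    using ij by (simp add: scalar_prod_def bordered_def atLeast0LessThan)
  also have "\<dots> = (\<Sum>k<?n. if k = 0 then ?A $$ (i, 0) * ?B $$ (0, j)
      else (if i = 0 then b else R (e (i - 1)) (e (k - 1)))
         * (if j = 0 then c' else R' (e (k - 1)) (e (j - 1))))"
    using ij by (intro sum.cong) (auto simp: bordered_def)
  also have "\<dots> = ?A $$ (i, 0) * ?B $$ (0, j) + (\<Sum>w\<in>UNIV. (if i = 0 then b else R (e (i - 1)) w)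
         * (if j = 0 then c' else R' w (e (j - 1))))"
    by (rule sum_bordered[OF e])
  also have "\<dots> = ?C $$ (i, j)"
    using ij by (auto simp: bordered_def R R' simp flip: sum_distrib_left sum_distrib_right)
  finally show "(?A * ?B) $$ (i, j) = ?C $$ (i, j)" .
qed (simp_all add: bordered_def)

lemma mat_X_bordered: "mat_X e = bordered 0 1 (-1) rX e"
  by (rule eq_matI) (auto simp: mat_X_def bordered_def)

lemma mat_Y_bordered: "mat_Y e = bordered 0 0 0 rY e"
  by (rule eq_matI) (auto simp: mat_Y_def bordered_def)

lemma scalar_add_mult_mat:
  fixes X Z :: "'a::comm_ring_1 mat"
  assumes "X \<in> carrier_mat n n" "Z \<in> carrier_mat n n"
  shows "(a \<cdot>\<^sub>m 1\<^sub>m n + X) * Z = a \<cdot>\<^sub>m Z + X * Z" "(a \<cdot>\<^sub>m 1\<^sub>m n - X) * Z = a \<cdot>\<^sub>m Z - X * Z"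
    "Z * (a \<cdot>\<^sub>m 1\<^sub>m n + X) = a \<cdot>\<^sub>m Z + Z * X" "Z * (a \<cdot>\<^sub>m 1\<^sub>m n - X) = a \<cdot>\<^sub>m Z - Z * X"
  using assms
  by (simp_all add: add_mult_distrib_mat[of _ n n _ _ n] minus_mult_distrib_mat[of _ n n _ _ n]
      mult_add_distrib_mat[of _ n n _ n] mult_minus_distrib_mat[of _ n n _ n]
      mult_smult_assoc_mat[of _ n n _ n] mult_smult_distrib[of _ n n _ n])

context
  fixes e :: "nat \<Rightarrow> 'k::{finite, field}"
  assumes card: "CARD('k) mod 8 = 5" and e: "bij_betw e {..<CARD('k)} UNIV"
begin

lemma transpose_mat_X: "(mat_X e)\<^sup>T = - mat_X e"
  by (rule eq_matI) (auto simp: mat_X_def intro: rX_antisym[OF card])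

lemma transpose_mat_Y: "(mat_Y e)\<^sup>T = - mat_Y e"
  by (rule eq_matI) (auto simp: mat_Y_def intro: rY_antisym[OF card])

text \<open>The zero border of \<open>mat_Y e\<close> gives both products a zero border; the cores
  agree by reflection.\<close>

lemma mat_X_mat_Y_commute: "mat_X e * mat_Y e = mat_Y e * mat_X e"
  unfolding mat_X_bordered mat_Y_bordered
  by (simp add: bordered_mult[OF e] sum_rX[OF card] sum_rY[OF card] sum_rX_rY_commute)

text \<open>The border of \<open>mat_X e\<close> adds \<open>1 * (-1)\<close> to each core entry:
  this cancels the off-diagonal \<open>1\<close> and completes \<open>1 - int CARD('k)\<close> on
  the diagonal. The corner collects \<open>-1\<close> once for each field element.\<close>

lemma mat_X_mat_Y_squares:
  "mat_X e * mat_X e + mat_Y e * mat_Y e = (- int CARD('k)) \<cdot>\<^sub>m 1\<^sub>m (CARD('k) + 1)"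
proof -
  have inj: "e (i - Suc 0) = e (j - Suc 0) \<longleftrightarrow> i = j" if "0 < i" "0 < j" "i < CARD('k) + 1" "j < CARD('k) + 1"
    for i j
    using bij_betw_imp_inj_on[OF e] that by (auto dest!: inj_onD)
  have "(\<Sum>w\<in>UNIV. rX u w * rX w v) - 1 + (\<Sum>w\<in>UNIV. rY u w * rY w v) =
      (if u = v then - int CARD('k) else 0)" for u v :: 'k
    using sum_rX_rX_plus_rY_rY[OF card, of u v]
    by (cases "u = v") (simp_all add: sum.distrib)
  thus ?thesis
    unfolding mat_X_bordered mat_Y_bordered bordered_mult[OF e sum_rX[OF card]]
      bordered_mult[OF e sum_rY[OF card]]
    by (intro eq_matI) (auto simp: bordered_def inj)
qed

text \<open>Since \<open>2\<close> is a nonsquare, exactly one of \<open>d\<close> and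
  \<open>2 * d\<close> is a square for \<open>d \<noteq> 0\<close>, so the cores have complementary
  supports off the diagonal; the border is filled by \<open>mat_X e\<close> alone.\<close>

lemma mat_X_mat_Y_entries:
  assumes "i < CARD('k) + 1" "j < CARD('k) + 1"
  shows "i = j \<and> mat_X e $$ (i, j) = 0 \<and> mat_Y e $$ (i, j) = 0 \<or>
    i \<noteq> j \<and> mat_X e $$ (i, j) \<in> {1, -1} \<and> mat_Y e $$ (i, j) = 0 \<or>
    i \<noteq> j \<and> mat_X e $$ (i, j) = 0 \<and> mat_Y e $$ (i, j) \<in> {1, -1}"
proof (cases "i = 0 \<or> j = 0 \<or> i = j")
  case True
  thus ?thesis using assms by (auto simp: mat_X_def mat_Y_def rX_def rY_def)
next
  case False
  have odd: "odd CARD('k)" using card by presburger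
  let ?d = "e (j - 1) - e (i - 1)"
  have "e (i - 1) \<noteq> e (j - 1)"
    using bij_betw_imp_inj_on[OF e] assms False by (auto dest!: inj_onD)
  hence "quad_char ?d \<in> {1, -1}"
    using quad_char_values[of ?d] by (auto simp: quad_char_eq_0_iff)
  moreover have "quad_char (2 * ?d) = - quad_char ?d"
    by (simp only: quad_char_mult[OF odd] quad_char_two[OF card])
  ultimately have "(root_char ?d = 0) \<noteq> (root_char (2 * ?d) = 0)"
    unfolding root_char_eq_0_iff by auto
  thus ?thesis
    using root_char_values[of ?d] root_char_values[of "2 * ?d"] assms False
    by (auto simp: mat_X_def mat_Y_def rX_def rY_def)
qed

section \<open>The generator matrix and its Gram matrix\<close>

lemma NV_generator_block:
  "NV_generator a e = four_block_mat (a \<cdot>\<^sub>m 1\<^sub>m (CARD('k) + 1) + mat_X e) (mat_Y e)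
     (mat_Y e) (a \<cdot>\<^sub>m 1\<^sub>m (CARD('k) + 1) - mat_X e)"
  \<comment> \<open>Skewness turns the lower blocks into \<open>Y\<close> and
    \<open>a I - X\<close>.\<close>
  unfolding NV_generator_def transpose_mat_X transpose_mat_Y
  by (rule eq_matI) (auto simp: mat_X_def mat_Y_def)

lemma transpose_NV_generator:
  "(NV_generator a e)\<^sup>T = four_block_mat (a \<cdot>\<^sub>m 1\<^sub>m (CARD('k) + 1) - mat_X e) (- mat_Y e)
     (- mat_Y e) (a \<cdot>\<^sub>m 1\<^sub>m (CARD('k) + 1) + mat_X e)"
proof -
  let ?n = "CARD('k) + 1"
  have c: "mat_X e \<in> carrier_mat ?n ?n" "mat_Y e \<in> carrier_mat ?n ?n"
    by (simp_all add: mat_X_def mat_Y_def)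
  have "(a \<cdot>\<^sub>m 1\<^sub>m ?n + mat_X e)\<^sup>T = a \<cdot>\<^sub>m 1\<^sub>m ?n - mat_X e"
      "(a \<cdot>\<^sub>m 1\<^sub>m ?n - mat_X e)\<^sup>T = a \<cdot>\<^sub>m 1\<^sub>m ?n + mat_X e"
    by (intro eq_matI; auto simp: mat_X_def rX_def[of "e i" "e i" for i]
        intro: rX_antisym[OF card] rX_antisym[OF card, symmetric])+
  thus ?thesis
    unfolding NV_generator_block using c
    by (subst transpose_four_block_mat[of _ ?n ?n]) (auto simp: transpose_mat_Y)
qed

lemma NV_generator_carrier: "NV_generator a e \<in> carrier_mat (2 * (CARD('k) + 1)) (2 * (CARD('k) + 1))"
  unfolding NV_generator_block by (rule carrier_matI) (simp_all add: mat_X_def mat_Y_def)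

lemma NV_generator_add_transpose:
  "NV_generator a e + (NV_generator a e)\<^sup>T = (2 * a) \<cdot>\<^sub>m 1\<^sub>m (2 * (CARD('k) + 1))"
  unfolding transpose_NV_generator unfolding NV_generator_block
  by (rule eq_matI) (auto simp: mat_X_def mat_Y_def)

lemma NV_generator_mult_transpose:
  "NV_generator a e * (NV_generator a e)\<^sup>T = (a\<^sup>2 + int CARD('k)) \<cdot>\<^sub>m 1\<^sub>m (2 * (CARD('k) + 1))"
proof -
  let ?n = "CARD('k) + 1"
  define X Y I where "X = mat_X e" and "Y = mat_Y e" and "I = (1\<^sub>m ?n :: int mat)"
  have c: "X \<in> carrier_mat ?n ?n" "Y \<in> carrier_mat ?n ?n" "I \<in> carrier_mat ?n ?n"
    by (simp_all add: mat_X_def mat_Y_def X_def Y_def I_def)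
  have XY: "X * Y = Y * X" unfolding X_def Y_def by (rule mat_X_mat_Y_commute)
  have sq: "X * X + Y * Y = (- int CARD('k)) \<cdot>\<^sub>m I"
    unfolding X_def Y_def I_def by (rule mat_X_mat_Y_squares)
  have sq': "(X * X) $$ (i, j) + (Y * Y) $$ (i, j) = - int CARD('k) * I $$ (i, j)"
    if "i < ?n" "j < ?n" for i j
    using arg_cong[OF sq, of "\<lambda>A. A $$ (i, j)"] c that by (simp del: index_mult_mat(1))
  let ?P = "a \<cdot>\<^sub>m I + X" and ?M = "a \<cdot>\<^sub>m I - X"
  note shift = scalar_add_mult_mat[OF c(1), of _ a, folded I_def]
  have PM: "?P * ?M = (a\<^sup>2) \<cdot>\<^sub>m I - X * X" and MP: "?M * ?P = (a\<^sup>2) \<cdot>\<^sub>m I - X * X"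
    using c by (subst shift; simp; subst shift; simp;
      intro eq_matI; simp add: algebra_simps power2_eq_square del: index_mult_mat(1))+
  \<comment> \<open>The off-diagonal blocks of the Gram matrix are commutators of \<open>Y\<close>
    with \<open>a I + X\<close> and \<open>a I - X\<close>.\<close>
  have off: "- (?P * Y) + Y * ?P = 0\<^sub>m ?n ?n" "Y * ?M + - (?M * Y) = 0\<^sub>m ?n ?n"
    using c by (intro eq_matI; simp add: shift XY del: index_mult_mat(1))+
  have diag: "(a\<^sup>2) \<cdot>\<^sub>m I - X * X + - (Y * Y) = (a\<^sup>2 + int CARD('k)) \<cdot>\<^sub>m I"
    "- (Y * Y) + ((a\<^sup>2) \<cdot>\<^sub>m I - X * X) = (a\<^sup>2 + int CARD('k)) \<cdot>\<^sub>m I"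
    using c sq' by (intro eq_matI; simp add: algebra_simps del: index_mult_mat(1))+
  have "NV_generator a e * (NV_generator a e)\<^sup>T =
      four_block_mat ((a\<^sup>2 + int CARD('k)) \<cdot>\<^sub>m I) (0\<^sub>m ?n ?n) (0\<^sub>m ?n ?n) ((a\<^sup>2 + int CARD('k)) \<cdot>\<^sub>m I)"
    unfolding transpose_NV_generator unfolding NV_generator_block
      X_def[symmetric] Y_def[symmetric] I_def[symmetric]
    using c by (subst mult_four_block_mat[of _ ?n ?n _ ?n _ ?n _ _ ?n _ ?n]) (simp_all add: PM MP off[simplified] diag minus_carrier_mat)
  also have "\<dots> = (a\<^sup>2 + int CARD('k)) \<cdot>\<^sub>m 1\<^sub>m (2 * ?n)"
    unfolding I_def by (rule eq_matI) auto
  finally show ?thesis .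
qed

end

subsection \<open>The ternary code\<close>

lemma scalar_mult_vec:
  fixes x :: "'a::comm_ring_1 vec"
  assumes "x \<in> carrier_vec n"
  shows "(c \<cdot>\<^sub>m 1\<^sub>m n) *\<^sub>v x = c \<cdot>\<^sub>v x"
proof (rule eq_vecI)
  fix i assume "i < dim_vec (c \<cdot>\<^sub>v x)"
  hence i: "i < n" using assms by simp
  hence "row (c \<cdot>\<^sub>m 1\<^sub>m n) i = c \<cdot>\<^sub>v unit_vec n i" by (intro eq_vecI) auto
  thus "((c \<cdot>\<^sub>m 1\<^sub>m n) *\<^sub>v x) $ i = (c \<cdot>\<^sub>v x) $ i" using i assms by simp
qed (use assms in simp)

text \<open>The first identity puts the row space inside its dual. For the converse,
  \<open>x\<close> in the dual satisfies \<open>G x = 0\<close>, and the second identity exhibits it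
  as a combination of rows.\<close>

lemma self_dual_row_space:
  fixes G :: "'f::field mat"
  assumes G: "G \<in> carrier_mat n n" and GG: "G * G\<^sup>T = 0\<^sub>m n n"
    and sum: "G + G\<^sup>T = c \<cdot>\<^sub>m 1\<^sub>m n" and "c \<noteq> 0"
  shows "self_dual_code n (vec_space.row_space n G)"
proof -
  have space: "vec_space.row_space n G = {G\<^sup>T *\<^sub>v y | y. y \<in> carrier_vec n}"
    using vec_space.row_space_eq[OF G] G by auto
  have GT: "G\<^sup>T \<in> carrier_mat n n" using G by simp
  have dot: "x \<bullet> (G\<^sup>T *\<^sub>v y) = (G *\<^sub>v x) \<bullet> y" if "x \<in> carrier_vec n" "y \<in> carrier_vec n" for x y
    using transpose_vec_mult_scalar[OF GT that(2,1)] G that by (simp add: comm_scalar_prod[of _ n])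
  have self_orth: "(G\<^sup>T *\<^sub>v x) \<bullet> (G\<^sup>T *\<^sub>v y) = 0" if "x \<in> carrier_vec n" "y \<in> carrier_vec n" for x y
  proof -
    have "G *\<^sub>v (G\<^sup>T *\<^sub>v x) = (G * G\<^sup>T) *\<^sub>v x"
      using G GT that by simp
    also have "\<dots> = 0\<^sub>v n" unfolding GG using that by (intro eq_vecI) (auto simp: scalar_prod_def)
    finally show ?thesis using dot[of "G\<^sup>T *\<^sub>v x" y] GT that by simp
  qed
  have orth: "\<exists>y \<in> carrier_vec n. x = G\<^sup>T *\<^sub>v y"
    if x: "x \<in> carrier_vec n" and orth: "\<And>y. y \<in> carrier_vec n \<Longrightarrow> x \<bullet> (G\<^sup>T *\<^sub>v y) = 0" for x
  proof -
    \<comment> \<open>Testing \<open>x\<close> against each row, that is with \<open>y\<close> a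
      unit vector, gives the coordinates of \<open>G x\<close>.\<close>
    have "G *\<^sub>v x = 0\<^sub>v n"
    proof (rule eq_vecI)
      fix i assume "i < dim_vec (0\<^sub>v n)"
      thus "(G *\<^sub>v x) $ i = 0\<^sub>v n $ i"
        using orth[of "unit_vec n i"] dot[OF x, of "unit_vec n i"] G x by simp
    qed (use G in simp)
    \<comment> \<open>Adding the zero vector \<open>G x\<close> makes the scalar matrix
      \<open>G + G\<^sup>T\<close> appear; dividing by \<open>c\<close> gives the coefficients
      \<open>inverse c \<cdot>\<^sub>v x\<close>.\<close>
    hence "G\<^sup>T *\<^sub>v x = G *\<^sub>v x + G\<^sup>T *\<^sub>v x" using GT x by simp
    also have "\<dots> = (G + G\<^sup>T) *\<^sub>v x" using G GT x by (simp add: add_mult_distrib_mat_vec)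
    also have "\<dots> = c \<cdot>\<^sub>v x" unfolding sum by (rule scalar_mult_vec[OF x])
    finally have "G\<^sup>T *\<^sub>v (inverse c \<cdot>\<^sub>v x) = inverse c \<cdot>\<^sub>v (c \<cdot>\<^sub>v x)"
      using mult_mat_vec[OF GT x] by simp
    hence "x = G\<^sup>T *\<^sub>v (inverse c \<cdot>\<^sub>v x)" using assms(4) x by (simp add: smult_smult_assoc)
    thus ?thesis using x by (intro bexI[of _ "inverse c \<cdot>\<^sub>v x"]) auto
  qed
  show ?thesis unfolding self_dual_code_def space
  proof (intro subset_antisym subsetI CollectI conjI ballI)
    fix x assume "x \<in> {x \<in> carrier_vec n. \<forall>c\<in>{G\<^sup>T *\<^sub>v y | y. y \<in> carrier_vec n}. x \<bullet> c = 0}"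
    hence "\<exists>y \<in> carrier_vec n. x = G\<^sup>T *\<^sub>v y" by (intro orth) auto
    thus "\<exists>y. x = G\<^sup>T *\<^sub>v y \<and> y \<in> carrier_vec n" by auto
  qed (use GT self_orth in auto)
qed

text \<open>The entries of row \<open>i\<close> of \<open>K\<close> are the coefficients that
  combine the rows of \<open>G\<close> into row \<open>i\<close> of the product.\<close>

lemma row_mult_in_row_space:
  fixes K G :: "'f::field mat"
  assumes K: "K \<in> carrier_mat m n'" and G: "G \<in> carrier_mat n' n" and "i < m"
  shows "row (K * G) i \<in> vec_space.row_space n G"
proof -
  have "row (K * G) i = G\<^sup>T *\<^sub>v row K i"
    using assms by (intro eq_vecI) (auto simp: comm_scalar_prod[of _ n'])
  thus ?thesis unfolding vec_space.row_space_eq[OF G] using assms by auto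
qed

section \<open>The Hadamard multiplier\<close>

definition hadamard_multiplier :: "nat \<Rightarrow> int mat" where
  "hadamard_multiplier n = four_block_mat (1\<^sub>m n) (1\<^sub>m n) (- 1\<^sub>m n) (1\<^sub>m n)"

lemma hadamard_multiplier_carrier: "hadamard_multiplier n \<in> carrier_mat (2 * n) (2 * n)"
  unfolding hadamard_multiplier_def by (rule carrier_matI) simp_all

text \<open>The multiplier is the Kronecker product of an order-2 Hadamard matrix with the
  identity.\<close>

lemma hadamard_multiplier_mult_transpose:
  "hadamard_multiplier n * (hadamard_multiplier n)\<^sup>T = 2 \<cdot>\<^sub>m 1\<^sub>m (2 * n)"
proof -
  have T: "(hadamard_multiplier n)\<^sup>T = four_block_mat (1\<^sub>m n) (- 1\<^sub>m n) (1\<^sub>m n) (1\<^sub>m n)"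
    unfolding hadamard_multiplier_def by (rule eq_matI) auto
  show ?thesis
    unfolding T unfolding hadamard_multiplier_def
    by (subst mult_four_block_mat[of _ n n _ n _ n _ _ n _ n]) (simp_all, intro eq_matI, auto)
qed

text \<open>Every block is a signed sum of \<open>a I\<close>, \<open>X\<close> and
  \<open>Y\<close>, each occurring once, and at each position exactly one of the three is nonzero,
  with value \<open>1\<close> or \<open>-1\<close>.\<close>

lemma hadamard_mult_entries:
  fixes e :: "nat \<Rightarrow> 'k::{finite, field}"
  assumes card: "CARD('k) mod 8 = 5" and e: "bij_betw e {..<CARD('k)} UNIV" and a: "a \<in> {1, -1}"
    and ij: "i < 2 * (CARD('k) + 1)" "j < 2 * (CARD('k) + 1)"
  shows "(hadamard_multiplier (CARD('k) + 1) * NV_generator a e) $$ (i, j) \<in> {1, -1}"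
proof -
  define n where "n = CARD('k) + 1"
  define X Y I where "X = mat_X e" and "Y = mat_Y e" and "I = (1\<^sub>m n :: int mat)"
  have c: "X \<in> carrier_mat n n" "Y \<in> carrier_mat n n" "I \<in> carrier_mat n n"
    by (simp_all add: mat_X_def mat_Y_def X_def Y_def I_def n_def)
  let ?P = "a \<cdot>\<^sub>m I + X" and ?M = "a \<cdot>\<^sub>m I - X"
  have prod: "hadamard_multiplier n * NV_generator a e = four_block_mat (?P + Y) (Y + ?M) (- ?P + Y) (- Y + ?M)"
    unfolding hadamard_multiplier_def NV_generator_block[OF card e]
      X_def[symmetric] Y_def[symmetric] n_def[symmetric] I_def[symmetric]
    using c by (subst mult_four_block_mat[of _ n n _ n _ n _ _ n _ n]) (simp_all add: I_def minus_carrier_mat)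
  have entries: "k = l \<and> X $$ (k, l) = 0 \<and> Y $$ (k, l) = 0 \<or>
      k \<noteq> l \<and> X $$ (k, l) \<in> {1, -1} \<and> Y $$ (k, l) = 0 \<or>
      k \<noteq> l \<and> X $$ (k, l) = 0 \<and> Y $$ (k, l) \<in> {1, -1}" if "k < n" "l < n" for k l
    using mat_X_mat_Y_entries[OF card e, of k l] that unfolding X_def Y_def n_def .
  have block: "(?P + Y) $$ (k, l) \<in> {1, -1}" "(Y + ?M) $$ (k, l) \<in> {1, -1}"
    "(- ?P + Y) $$ (k, l) \<in> {1, -1}" "(- Y + ?M) $$ (k, l) \<in> {1, -1}" if "k < n" "l < n" for k l
    using entries[OF that] a c that by (auto simp: I_def)
  have "i < n \<or> n \<le> i \<and> i - n < n" "j < n \<or> n \<le> j \<and> j - n < n"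
    using ij unfolding n_def by auto
  hence "four_block_mat (?P + Y) (Y + ?M) (- ?P + Y) (- Y + ?M) $$ (i, j) \<in> {1, -1}"
    using block[of i j] block[of i "j - n"] block[of "i - n" j] block[of "i - n" "j - n"] c ij
    unfolding n_def[symmetric] by (elim disjE) (auto simp del: index_add_mat(1) index_minus_mat(1))
  thus ?thesis unfolding n_def[symmetric] prod .
qed

section \<open>Reduction modulo 3 and the codewords\<close>

lemma F3_three_eq_0: "(3 :: F3) = 0"
  using of_nat_card_eq_0[where 'a = Enum.finite_3] by (simp add: UNIV_finite_3)

lemma F3_two_neq_0: "(2 :: F3) \<noteq> 0"
proof
  assume "(2 :: F3) = 0"
  moreover have "(3 :: F3) = 2 + 1" by simp
  ultimately show False using F3_three_eq_0 by simp
qed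

lemma F3_one_neq_minus_one: "(1 :: F3) \<noteq> -1"
  using F3_two_neq_0 by (metis add.right_inverse one_add_one)

lemma F3_to_int_of_int: "h \<in> {1, -1} \<Longrightarrow> F3_to_int (of_int h) = h"
  using F3_one_neq_minus_one by (auto simp: F3_to_int_def)

theorem theorem3p1:
  fixes p :: nat and a :: int and e :: "nat \<Rightarrow> 'k::{finite, field}"
  assumes "prime p" and "[p = 5] (mod 24)" and "CARD('k) = p"
    and "bij_betw e {..<p} (UNIV :: 'k set)"
    and "a \<in> {1, -1}"
  shows "self_dual_code (2 * (p + 1)) (NV a e) \<and>
    (\<exists>cs :: F3 vec list. distinct cs \<and> length cs = 2 * (p + 1) \<and>
       (\<forall>c \<in> set cs. c \<in> NV a e \<and> weight c = 2 * (p + 1)) \<and>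
       hadamard_matrix (2 * (p + 1)) (mat_of_rows (2 * (p + 1)) (map (map_vec F3_to_int) cs)))"
proof
  define N where "N = 2 * (p + 1)"
  have mod24: "p mod 24 = 5" using assms(2) by (simp add: cong_def)
  have card: "CARD('k) mod 8 = 5" unfolding assms(3) using mod24 by presburger
  have e: "bij_betw e {..<CARD('k)} UNIV" using assms(3,4) by simp
  have N: "N = 2 * (CARD('k) + 1)" by (simp add: N_def assms(3))
  have a2: "a\<^sup>2 = 1" using assms(5) by auto
  define G where "G = NV_generator a e"
  have G: "G \<in> carrier_mat N N" unfolding G_def N by (rule NV_generator_carrier[OF card e])
  have GG: "G * G\<^sup>T = int (p + 1) \<cdot>\<^sub>m 1\<^sub>m N"
    using NV_generator_mult_transpose[OF card e, of a] a2 by (simp add: G_def N assms(3) add.commute)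
  have GS: "G + G\<^sup>T = (2 * a) \<cdot>\<^sub>m 1\<^sub>m N"
    using NV_generator_add_transpose[OF card e, of a] by (simp add: G_def N)
  define G3 where "G3 = (map_mat of_int G :: F3 mat)"
  have NV: "NV a e = vec_space.row_space N G3" by (simp add: NV_def G3_def G_def N)
  have G3: "G3 \<in> carrier_mat N N" using G by (simp add: G3_def)
  have scalar: "map_mat of_int (c \<cdot>\<^sub>m 1\<^sub>m N) = (of_int c :: F3) \<cdot>\<^sub>m 1\<^sub>m N" for c
    by (rule eq_matI) auto
  \<comment> \<open>The residue modulo \<open>24\<close> also gives \<open>p \<equiv> 2\<close>
    modulo \<open>3\<close>, which annihilates the scalar in \<open>GG\<close>.\<close>
  have "3 dvd int (p + 1)" using mod24 by presburger
  then obtain m where "int (p + 1) = 3 * m" by blast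
  hence "of_int (int (p + 1)) = (of_int (3 * m) :: F3)" by (rule arg_cong)
  hence zero: "of_int (int (p + 1)) = (0 :: F3)"
    unfolding of_int_mult by (simp only: of_int_numeral F3_three_eq_0 mult_zero_left)
  have "G3 * G3\<^sup>T = map_mat of_int (G * G\<^sup>T)"
    unfolding G3_def map_mat_transpose
    by (rule of_int_hom.mat_hom_mult[symmetric, OF G]) (use G in simp)
  also have "\<dots> = 0\<^sub>m N N" unfolding GG scalar zero by (rule eq_matI) auto
  finally have GG3: "G3 * G3\<^sup>T = 0\<^sub>m N N" .
  have "G3 + G3\<^sup>T = map_mat of_int (G + G\<^sup>T)"
    unfolding G3_def using G by (intro eq_matI) auto
  also have "\<dots> = of_int (2 * a) \<cdot>\<^sub>m 1\<^sub>m N" unfolding GS scalar ..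
  finally have GS3: "G3 + G3\<^sup>T = of_int (2 * a) \<cdot>\<^sub>m 1\<^sub>m N" .
  have "of_int (2 * a) \<noteq> (0 :: F3)" using assms(5) F3_two_neq_0 by auto
  thus "self_dual_code (2 * (p + 1)) (NV a e)"
    unfolding NV N_def[symmetric] by (rule self_dual_row_space[OF G3 GG3 GS3])

  define K where "K = hadamard_multiplier (CARD('k) + 1)"
  define H where "H = K * G"
  have K: "K \<in> carrier_mat N N" unfolding K_def N by (rule hadamard_multiplier_carrier)
  have H: "H \<in> carrier_mat N N" using K G by (simp add: H_def)
  have entries: "H $$ (i, j) \<in> {1, -1}" if "i < N" "j < N" for i j
    using hadamard_mult_entries[OF card e assms(5)] that unfolding H_def K_def G_def N .
  \<comment> \<open>The inner product \<open>G * G\<^sup>T\<close> is scalar and moves out; its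
    factor \<open>p + 1\<close> and the factor \<open>2\<close> from \<open>K\<close> multiply to
    \<open>N\<close>.\<close>
  have "H * H\<^sup>T = K * (G * G\<^sup>T) * K\<^sup>T"
    unfolding H_def using K G
    by (simp add: transpose_mult[of _ N N _ N] assoc_mult_mat[of _ N N _ N _ N])
  also have "\<dots> = int (p + 1) \<cdot>\<^sub>m (K * K\<^sup>T)"
    unfolding GG using K
    by (simp add: mult_smult_distrib[of _ N N _ N] mult_smult_assoc_mat[of _ N N _ N])
  also have "\<dots> = int N \<cdot>\<^sub>m 1\<^sub>m N"
    unfolding K_def hadamard_multiplier_mult_transpose N[symmetric]
    by (rule eq_matI) (auto simp: N_def)
  finally have HH: "H * H\<^sup>T = int N \<cdot>\<^sub>m 1\<^sub>m N" .
  have hadamard: "hadamard_matrix N H"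
    unfolding hadamard_matrix_def using H entries HH by blast

  \<comment> \<open>The codewords are the rows of \<open>H\<close> modulo \<open>3\<close>; reading
    them back recovers \<open>H\<close>, as its entries are \<open>1\<close> or
    \<open>-1\<close>.\<close>
  define H3 where "H3 = (map_mat of_int H :: F3 mat)"
  have H3: "H3 \<in> carrier_mat N N" using H by (simp add: H3_def)
  have entries3: "F3_to_int (H3 $$ (i, j)) = H $$ (i, j)" if "i < N" "j < N" for i j
    using F3_to_int_of_int[OF entries[OF that]] H that by (simp add: H3_def)
  have nonzero: "H3 $$ (i, j) \<noteq> 0" if "i < N" "j < N" for i j
    using entries3[OF that] entries[OF that] by (auto simp: F3_to_int_def)
  have H_rows: "mat_of_rows N (map (map_vec F3_to_int) (rows H3)) = H"
    using H H3 by (intro eq_matI) (auto simp: mat_of_rows_def entries3)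
  \<comment> \<open>Reduction commutes with the product, so the rows of \<open>H3\<close> are
    combinations of the generators of the code.\<close>
  have "H3 = map_mat of_int K * G3"
    unfolding H3_def H_def G3_def by (rule of_int_hom.mat_hom_mult[OF K G])
  hence in_code: "row H3 i \<in> NV a e" if "i < N" for i
    unfolding NV using row_mult_in_row_space[of "map_mat of_int K" N N G3 N i] K G3 that by simp
  have "weight (row H3 i) = N" if "i < N" for i
  proof -
    have "{j. j < dim_vec (row H3 i) \<and> row H3 i $ j \<noteq> 0} = {..<N}"
      using H3 nonzero[OF that] that by auto
    thus ?thesis by (simp add: weight_def)
  qed
  moreover have "distinct (rows H3)"
  proof -
    have "i = j" if ij: "i < N" "j < N" and eq: "row H3 i = row H3 j" for i j
    proof (rule ccontr)
      assume "i \<noteq> j"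
      have "H $$ (i, k) = H $$ (j, k)" if "k < N" for k
        using arg_cong[OF eq, of "\<lambda>v. F3_to_int (v $ k)"] entries3 ij that H3 by simp
      hence "row H i = row H j" using H ij by (intro eq_vecI) auto
      \<comment> \<open>Equal rows would force the off-diagonal entry \<open>0\<close> to equal the
        diagonal entry \<open>N\<close>.\<close>
      hence "(H * H\<^sup>T) $$ (i, j) = (H * H\<^sup>T) $$ (i, i)" using H ij by simp
      thus False unfolding HH using ij \<open>i \<noteq> j\<close> by simp
    qed
    thus ?thesis using H3 by (auto simp: distinct_conv_nth)
  qed
  ultimately show "\<exists>cs :: F3 vec list. distinct cs \<and> length cs = 2 * (p + 1) \<and>
       (\<forall>c \<in> set cs. c \<in> NV a e \<and> weight c = 2 * (p + 1)) \<and>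
       hadamard_matrix (2 * (p + 1)) (mat_of_rows (2 * (p + 1)) (map (map_vec F3_to_int) cs))"
    using H3 in_code hadamard H_rows unfolding N_def[symmetric]
    by (intro exI[of _ "rows H3"]) (auto simp: in_set_conv_nth)
qed

end
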